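(* Let $\mathcal H$ be a Hilbert lattice, let $A$ be a positive power compact operator on $\mathcal H$, and suppose that the operator $C=A^*A-AA^*$ is positive. Then $C=0$. That is, the zero operator is the only positive operator on a Hilbert lattice that is a self-commutator of a positive power compact operator.
   Context: A Hilbert lattice is a (real) Banach lattice whose norm is induced by an inner product; $A^*$ denotes the Hilbert space adjoint of the bounded operator $A$. An operator on a vector lattice is called positive if it maps the positive cone into itself (this is not positive semi-definiteness). The self-commutator of $A$ is $[A^*,A]=A^*A-AA^*$. A bounded operator on a Banach space is power compact if some power $A^n$, $n\ge 1$, of it is a compact operator. *)

theory Defs
  imports "HOL-Analysis.Analysis" "HOL-Library.Lattice_Algebras"
begin

(* The lattice operations come from lattice_ab_group_add_abs, where the modulus is
   \<bar>x\<bar> = sup x (- x). *)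
class hilbert_lattice =
  real_inner + complete_space + ordered_real_vector + lattice_ab_group_add_abs +
  assumes lattice_norm: "\<bar>x\<bar> \<le> \<bar>y\<bar> \<Longrightarrow> norm x \<le> norm y"

(* Maps the positive cone into itself; this is not positive semidefiniteness. *)
definition positive_operator :: "('a::ordered_real_vector \<Rightarrow> 'a) \<Rightarrow> bool" where
  "positive_operator T \<longleftrightarrow> linear T \<and> (\<forall>x. 0 \<le> x \<longrightarrow> 0 \<le> T x)"

definition compact_operator :: "('a::real_normed_vector \<Rightarrow> 'b::real_normed_vector) \<Rightarrow> bool" where
  "compact_operator T \<longleftrightarrow> bounded_linear T \<and> (\<forall>S. bounded S \<longrightarrow> compact (closure (T ` S)))"

definition power_compact :: "('a::real_normed_vector \<Rightarrow> 'a) \<Rightarrow> bool" where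
  "power_compact T \<longleftrightarrow> bounded_linear T \<and> (\<exists>n\<ge>1. compact_operator (T ^^ n))"

(* The library's adjoint is chosen by SOME; it is the Hilbert space adjoint here because,
   for bounded operators on a complete space, a map T' with
   T x \<bullet> y = x \<bullet> T' y exists (Riesz) and is unique. *)
definition self_commutator :: "('a::real_inner \<Rightarrow> 'a) \<Rightarrow> 'a \<Rightarrow> 'a" where
  "self_commutator T = (\<lambda>x. adjoint T (T x) - T (adjoint T x))"

end

theory Submission
  imports Defs
begin

text \<open>
  Write \<open>D\<close> for the adjoint of \<open>A\<close> and \<open>C = D A - A D\<close>.  The cone of a Hilbert lattice is self-dual,
  so order inequalities between positive operators turn into norm inequalities on positive
  vectors.  In particular \<open>C \<ge> 0\<close> gives \<open>\<parallel>D (A v)\<parallel> \<le> \<parallel>A (A v)\<parallel>\<close>, and hence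
  \<open>\<parallel>A v\<parallel>\<^sup>2 \<le> \<parallel>A (A v)\<parallel> \<parallel>v\<parallel>\<close>, for every positive \<open>v\<close>
  (lemma \<open>positive_commutator_paranormal\<close>): on the cone, \<open>A\<close> satisfies the inequality that defines
  paranormal operators, and the classical argument that a power compact paranormal operator attains
  its norm along entire orbits can be run inside the cone.

  Let \<open>P\<close> be a closed cone of positive vectors invariant under \<open>A\<close> and \<open>D\<close>, suppose that
  \<open>A\<close> does not vanish on \<open>P\<close>, and let \<open>N\<close> be the norm of \<open>A\<close> on \<open>P\<close>.  The inequality makes the ratios \<open>\<parallel>A\<^sup>k\<^sup>+\<^sup>1 v\<parallel> / \<parallel>A\<^sup>k v\<parallel>\<close> nondecreasing in \<open>k\<close>, so a unit vector
  that almost attains \<open>N\<close> has an orbit that almost attains \<open>N\<close> at each step.  Going far along such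
  orbits and passing to a limit, which exists because some power of \<open>A\<close> is compact, gives a unit
  vector \<open>z\<close> in \<open>P\<close> with \<open>\<parallel>A\<^sup>k z\<parallel> = N\<^sup>k = \<parallel>D\<^sup>k z\<parallel>\<close> for all \<open>k\<close> (lemma \<open>extremal_vector\<close>).  The vectors with this
  two-sided property are invariant under \<open>A\<close> and \<open>D\<close> and satisfy \<open>D (A u) = N\<^sup>2 u = A (D u)\<close>, so \<open>C\<close> vanishes
  on them (lemma \<open>normal_part_in_cone\<close>).

  Now let \<open>E\<close> be the largest set of positive vectors that is invariant under \<open>A\<close> and \<open>D\<close> and killed by
  \<open>C\<close>, and let \<open>P\<close> consist of the positive vectors orthogonal to \<open>E\<close>.  If \<open>A\<close> did not vanish on \<open>P\<close>, the
  vector \<open>z\<close> just found would lie in both \<open>E\<close> and \<open>P\<close>, which is absurd.  So \<open>A\<close>, \<open>D\<close> and \<open>C\<close> vanish on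
  \<open>P\<close>.  Finally, for positive \<open>y\<close> the vector \<open>C y\<close> is positive and orthogonal to \<open>E\<close>, because \<open>C\<close> is
  symmetric and kills \<open>E\<close>.  Thus \<open>C y\<close> is in \<open>P\<close>, so \<open>C (C y) = 0\<close> and \<open>\<parallel>C y\<parallel>\<^sup>2 = y \<bullet> C (C y) = 0\<close>.
\<close>

section \<open>The Hilbert space adjoint\<close>

text \<open>
  The representing vector is the minimiser of the energy \<open>J x = \<parallel>x\<parallel>\<^sup>2 - 2 f x\<close>: by the parallelogram law
  minimising sequences of \<open>J\<close> are Cauchy, and stationarity of \<open>J\<close> at the minimiser \<open>z\<close> says \<open>f x = x \<bullet> z\<close>.
\<close>

lemma riesz_representation:
  fixes f :: "'a::{real_inner,complete_space} \<Rightarrow> real"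
  assumes "bounded_linear f"
  shows "\<exists>z. \<forall>x. f x = x \<bullet> z"
proof -
  interpret f: bounded_linear f by fact
  obtain K where K: "\<And>x. norm (f x) \<le> norm x * K" using f.bounded by blast
  define J where "J x = x \<bullet> x - 2 * f x" for x
  have J_low: "- (K^2) \<le> J x" for x
  proof -
    have "f x \<le> norm x * K" using K[of x] by simp
    moreover have "0 \<le> (norm x - K)^2" by simp
    ultimately show ?thesis
      unfolding J_def by (simp add: power2_diff dot_square_norm algebra_simps)
  qed
  define d where "d = Inf (range J)"
  have bdd: "bdd_below (range J)" using J_low by (intro bdd_belowI[of _ "- (K^2)"]) auto
  have d_le: "d \<le> J x" for x unfolding d_def by (intro cInf_lower bdd) auto
  have "\<exists>x. J x < d + 1 / real (Suc m)" for m
  proof -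
    have "Inf (range J) < d + 1 / real (Suc m)" unfolding d_def by simp
    then show ?thesis using cInf_lessD[of "range J"] by auto
  qed
  then obtain X where X: "\<And>m. J (X m) < d + 1 / real (Suc m)" by metis
  have par: "(norm (a - b))^2 \<le> 2 * (J a + J b - 2 * d)" for a b
  proof -
    have "J ((1/2) *\<^sub>R (a + b)) = (a \<bullet> a + b \<bullet> b + 2 * (a \<bullet> b)) / 4 - (f a + f b)"
      unfolding J_def by (simp add: f.scaleR f.add inner_add inner_commute algebra_simps)
    moreover have "(norm (a - b))^2 = a \<bullet> a + b \<bullet> b - 2 * (a \<bullet> b)"
      by (simp add: power2_norm_eq_inner inner_diff inner_commute)
    moreover have "p + q - 2 * r \<le> 2 * ((p - 2 * u) + (q - 2 * v) - 2 * e)"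
      if "e \<le> (p + q + 2 * r) / 4 - (u + v)" for p q r u v e :: real
      using that by (simp add: field_simps)
    ultimately show ?thesis using d_le[of "(1/2) *\<^sub>R (a + b)"]
      unfolding J_def[of a] J_def[of b] by metis
  qed
  have "Cauchy X"
  proof (rule CauchyI)
    fix e :: real assume "0 < e"
    then obtain M where M: "4 / e^2 < real M" using reals_Archimedean2 by blast
    have "norm (X m - X n) < e" if "M \<le> m" "M \<le> n" for m n
    proof -
      have sm: "J (X i) < d + e^2 / 4" if "M \<le> i" for i
      proof -
        have "4 / e^2 < real (Suc i)" using M that by linarith
        then have "1 / real (Suc i) < e^2 / 4" using \<open>0 < e\<close> by (simp add: field_simps)
        then show ?thesis using X[of i] by linarith
      qed
      have "(norm (X m - X n))^2 < e^2"
        using par[of "X m" "X n"] sm[OF that(1)] sm[OF that(2)] by simp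
      then show ?thesis using \<open>0 < e\<close> by (simp add: power_less_imp_less_base)
    qed
    then show "\<exists>M. \<forall>m\<ge>M. \<forall>n\<ge>M. norm (X m - X n) < e" by blast
  qed
  then obtain z where z: "X \<longlonglongrightarrow> z" using Cauchy_convergent convergent_def by blast
  have "(\<lambda>m. J (X m)) \<longlonglongrightarrow> J z"
    unfolding J_def by (intro tendsto_intros f.tendsto z)
  moreover have "(\<lambda>m. d + 1 / real (Suc m)) \<longlonglongrightarrow> d + 0"
    by (intro tendsto_intros LIMSEQ_Suc lim_1_over_n)
  ultimately have "J z \<le> d + 0" using X by (intro LIMSEQ_le) (auto intro: less_imp_le)
  then have z_min: "J z \<le> J x" for x using d_le[of x] by simp
  have "f x = x \<bullet> z" for x
  proof -
    define g where "g = x \<bullet> z - f x"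
    define q where "q = x \<bullet> x"
    have q: "0 \<le> q" unfolding q_def by simp
    have var: "0 \<le> 2 * t * g + t^2 * q" for t
      using z_min[of "z + t *\<^sub>R x"] unfolding J_def g_def q_def
      by (simp add: f.add f.scaleR inner_add inner_commute power2_eq_square algebra_simps)
    \<comment> \<open>A step \<open>- g / (q + 1)\<close> from \<open>z\<close> in direction \<open>x\<close> lowers \<open>J\<close> unless \<open>g = 0\<close>.\<close>
    define t where "t = - g / (q + 1)"
    have g: "g = - (t * (q + 1))" using q unfolding t_def by simp
    have "2 * t * g + t^2 * q = - (t^2 * (q + 2))"
      unfolding g by (simp add: power2_eq_square algebra_simps)
    with var[of t] have "t^2 * (q + 2) \<le> 0" by simp
    then have "t = 0" using q by (simp add: mult_le_0_iff)
    then have "g = 0" using g by simp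
    then show ?thesis unfolding g_def by simp
  qed
  then show ?thesis by blast
qed

lemma adjoint_inner:
  fixes T :: "'a::{real_inner,complete_space} \<Rightarrow> 'b::real_inner"
  assumes "bounded_linear T"
  shows "T x \<bullet> y = x \<bullet> adjoint T y"
proof -
  have "\<exists>z. \<forall>x. T x \<bullet> y = x \<bullet> z" for y
    by (intro riesz_representation bounded_linear_inner_left_comp assms)
  then have "\<exists>T'. \<forall>x y. T x \<bullet> y = x \<bullet> T' y" by metis
  then show ?thesis unfolding adjoint_def by (rule someI2_ex) blast
qed

lemma bounded_linear_adjoint:
  fixes T :: "'a::{real_inner,complete_space} \<Rightarrow> 'b::real_inner"
  assumes "bounded_linear T"
  shows "bounded_linear (adjoint T)"
proof -
  interpret T: bounded_linear T by fact
  note adj = adjoint_inner[OF assms]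
  obtain K where K0: "0 \<le> K" and K: "\<And>x. norm (T x) \<le> norm x * K"
    using T.nonneg_bounded by blast
  show ?thesis
  proof (rule bounded_linear_intro)
    show "adjoint T (x + y) = adjoint T x + adjoint T y" for x y
      by (rule vector_eq_ldot[THEN iffD1]) (simp add: inner_add_right flip: adj)
    show "adjoint T (r *\<^sub>R x) = r *\<^sub>R adjoint T x" for r x
      by (rule vector_eq_ldot[THEN iffD1]) (simp flip: adj)
    show "norm (adjoint T x) \<le> norm x * K" for x
    proof -
      have "norm (adjoint T x) * norm (adjoint T x) = T (adjoint T x) \<bullet> x"
        by (simp add: adj flip: power2_norm_eq_inner power2_eq_square)
      also have "\<dots> \<le> norm (T (adjoint T x)) * norm x" by (rule norm_cauchy_schwarz)
      also have "\<dots> \<le> (norm (adjoint T x) * K) * norm x" by (intro mult_right_mono K) simp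
      finally have le: "norm (adjoint T x) * norm (adjoint T x) \<le> norm (adjoint T x) * (norm x * K)"
        by (simp add: algebra_simps)
      show ?thesis
      proof (cases "adjoint T x = 0")
        case True
        then show ?thesis using K0 by simp
      next
        case False then show ?thesis using le by simp
      qed
    qed
  qed
qed

section \<open>The cone of a Hilbert lattice\<close>

lemma norm_abs_lattice: "norm \<bar>x\<bar> = norm (x::'a::hilbert_lattice)"
  by (intro antisym lattice_norm) simp_all

text \<open>
  For positive vectors \<open>\<bar>x - y\<bar> \<le> x + y\<close>, so \<open>\<parallel>x - y\<parallel> \<le> \<parallel>x + y\<parallel>\<close>; polarisation turns this into the claim.
\<close>

lemma inner_nonneg:
  fixes x y :: "'a::hilbert_lattice"
  assumes "0 \<le> x" "0 \<le> y"
  shows "0 \<le> x \<bullet> y"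
proof -
  have "\<bar>x - y\<bar> \<le> \<bar>x + y\<bar>"
    using assms abs_triangle_ineq4[of x y] by simp
  then have "(norm (x - y))^2 \<le> (norm (x + y))^2" by (intro power_mono lattice_norm) simp_all
  then show ?thesis by (simp add: power2_norm_eq_inner inner_diff inner_add inner_commute)
qed

text \<open>
  The cone is self-dual.  The positive and negative parts of \<open>x\<close> are orthogonal because their sum and
  their difference are \<open>x\<close> and \<open>\<bar>x\<bar>\<close>, which have the same norm.  Testing \<open>x\<close> against its own negative
  part therefore shows that this part is \<open>0\<close>.
\<close>

lemma nonneg_iff_inner_nonneg:
  fixes x :: "'a::hilbert_lattice"
  shows "0 \<le> x \<longleftrightarrow> (\<forall>y\<ge>0. 0 \<le> x \<bullet> y)"
proof
  assume dual: "\<forall>y\<ge>0. 0 \<le> x \<bullet> y"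
  have "norm (pprt x + nprt x) = norm (pprt x - nprt x)"
    by (metis norm_abs_lattice abs_prts prts)
  then have "(norm (pprt x + nprt x))^2 = (norm (pprt x - nprt x))^2" by simp
  then have orth: "pprt x \<bullet> nprt x = 0"
    by (simp add: power2_norm_eq_inner inner_diff inner_add inner_commute)
  have "0 \<le> x \<bullet> (- nprt x)"
    using dual[rule_format, of "- nprt x"] nprt_le_zero[of x] by simp
  also have "\<dots> = - (nprt x \<bullet> nprt x)"
    by (subst prts[of x]) (simp add: inner_add orth)
  finally have "nprt x = 0" by (metis inner_eq_zero_iff inner_ge_zero neg_0_le_iff_le order_antisym)
  then show "0 \<le> x" using prts[of x] zero_le_pprt[of x] by simp
qed (use inner_nonneg in blast)

lemma closed_nonneg_cone: "closed {x::'a::hilbert_lattice. 0 \<le> x}"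
proof -
  have "{x::'a. 0 \<le> x} = (\<Inter>y\<in>{y. 0 \<le> y}. {x. 0 \<le> x \<bullet> y})"
    using nonneg_iff_inner_nonneg by auto
  moreover have "closed {x::'a. 0 \<le> x \<bullet> y}" for y by (intro closed_Collect_le continuous_intros)
  ultimately show ?thesis by (metis (no_types, lifting) closed_INT)
qed

lemma positive_adjoint:
  fixes T :: "'a::hilbert_lattice \<Rightarrow> 'a"
  assumes "bounded_linear T" "positive_operator T" "0 \<le> y"
  shows "0 \<le> adjoint T y"
proof (rule nonneg_iff_inner_nonneg[THEN iffD2], intro allI impI)
  fix x :: 'a assume "0 \<le> x"
  then have "0 \<le> T x \<bullet> y"
    using assms unfolding positive_operator_def by (intro inner_nonneg) auto
  then show "0 \<le> adjoint T y \<bullet> x" by (simp add: inner_commute[of "adjoint T y"] flip: adjoint_inner[OF assms(1)])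
qed

text \<open>
  Since \<open>T v\<close> is positive, positivity of the self-commutator gives
  \<open>\<parallel>T\<^sup>* (T v)\<parallel>\<^sup>2 = T (T\<^sup>* (T v)) \<bullet> T v \<le> T\<^sup>* (T (T v)) \<bullet> T v = \<parallel>T (T v)\<parallel>\<^sup>2\<close>; combine this with
  \<open>\<parallel>T v\<parallel>\<^sup>2 = v \<bullet> T\<^sup>* (T v) \<le> \<parallel>v\<parallel> \<parallel>T\<^sup>* (T v)\<parallel>\<close>.
\<close>

lemma positive_commutator_paranormal:
  fixes T :: "'a::hilbert_lattice \<Rightarrow> 'a"
  assumes T: "bounded_linear T" "positive_operator T"
    and C: "positive_operator (self_commutator T)" and v: "0 \<le> v"
  shows "(norm (T v))^2 \<le> norm (T (T v)) * norm v"
proof -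
  note adj = adjoint_inner[OF T(1)]
  let ?D = "adjoint T"
  have Tv: "0 \<le> T v" using T v unfolding positive_operator_def by simp
  have "0 \<le> self_commutator T (T v)" using C Tv unfolding positive_operator_def by simp
  then have "0 \<le> self_commutator T (T v) \<bullet> T v" using Tv by (rule inner_nonneg)
  also have "\<dots> = ?D (T (T v)) \<bullet> T v - T (?D (T v)) \<bullet> T v"
    unfolding self_commutator_def by (simp add: inner_diff)
  also have "\<dots> = (norm (T (T v)))^2 - (norm (?D (T v)))^2"
    using adj[of "T v" "T (T v)"] adj[of "?D (T v)" "T v"]
    by (metis inner_commute power2_norm_eq_inner)
  finally have "(norm (?D (T v)))^2 \<le> (norm (T (T v)))^2" by simp
  then have "norm (?D (T v)) \<le> norm (T (T v))" by (rule power2_le_imp_le) simp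
  then have "norm (?D (T v)) * norm v \<le> norm (T (T v)) * norm v" by (rule mult_right_mono) simp
  moreover have "(norm (T v))^2 \<le> norm (?D (T v)) * norm v"
    using norm_cauchy_schwarz[of v "?D (T v)"]
    by (simp add: power2_norm_eq_inner mult.commute flip: adj)
  ultimately show ?thesis by linarith
qed

section \<open>Norm-attaining vectors in a cone\<close>

text \<open>
  A lower bound \<open>c\<close> for \<open>\<parallel>A v\<parallel> / \<parallel>v\<parallel>\<close> persists along the orbit of \<open>v\<close>, because the inequality \<open>para\<close>
  makes these ratios nondecreasing.
\<close>

lemma paranormal_growth:
  fixes A :: "'a::real_normed_vector \<Rightarrow> 'a"
  assumes lin: "linear A" and inv: "A ` P \<subseteq> P"
    and para: "\<forall>v\<in>P. (norm (A v))^2 \<le> norm (A (A v)) * norm v"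
    and v: "v \<in> P" and c: "0 \<le> c" "c * norm v \<le> norm (A v)"
  shows "(A ^^ k) v \<in> P" "c * norm ((A ^^ k) v) \<le> norm (A ((A ^^ k) v))"
    "c ^ k * norm v \<le> norm ((A ^^ k) v)"
proof -
  have step: "c * norm (A v) \<le> norm (A (A v))" if "v \<in> P" "c * norm v \<le> norm (A v)" for v
  proof (cases "v = 0")
    case False
    have "c * norm v * norm (A v) \<le> norm (A v) * norm (A v)"
      by (rule mult_right_mono[OF that(2)]) simp
    also have "\<dots> \<le> norm (A (A v)) * norm v" using para that(1) by (simp add: power2_eq_square)
    finally have "(c * norm (A v)) * norm v \<le> norm (A (A v)) * norm v" by (simp add: ac_simps)
    then show ?thesis using False by simp
  qed (simp add: linear_0[OF lin])
  have "(A ^^ k) v \<in> P \<and> c * norm ((A ^^ k) v) \<le> norm (A ((A ^^ k) v)) \<and>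
    c ^ k * norm v \<le> norm ((A ^^ k) v)"
  proof (induction k)
    case (Suc k)
    have "c ^ Suc k * norm v = c * (c ^ k * norm v)" by simp
    also have "\<dots> \<le> c * norm ((A ^^ k) v)" using Suc c(1) by (intro mult_left_mono) auto
    also have "\<dots> \<le> norm (A ((A ^^ k) v))" using Suc by simp
    finally show ?case using Suc inv step by auto
  qed (use v c in simp)
  then show "(A ^^ k) v \<in> P" "c * norm ((A ^^ k) v) \<le> norm (A ((A ^^ k) v))"
    "c ^ k * norm v \<le> norm ((A ^^ k) v)" by auto
qed

lemma inner_funpow_adjoint:
  fixes A D :: "'a::real_inner \<Rightarrow> 'a"
  assumes "\<And>x y. A x \<bullet> y = x \<bullet> D y"
  shows "(A ^^ k) x \<bullet> y = x \<bullet> (D ^^ k) y"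
  by (induction k arbitrary: y) (simp_all add: assms, simp add: funpow_swap1)

lemma bounded_linear_funpow:
  assumes "bounded_linear (A::'a::real_normed_vector \<Rightarrow> 'a)"
  shows "bounded_linear (A ^^ k)"
proof (induction k)
  case 0 then show ?case by (simp add: id_def bounded_linear_ident)
next
  case (Suc k) then show ?case by (simp add: comp_def bounded_linear_compose[OF assms])
qed

lemma norm_funpow_le:
  fixes A :: "'a::real_normed_vector \<Rightarrow> 'a"
  assumes inv: "A ` P \<subseteq> P" and le: "\<forall>v\<in>P. norm (A v) \<le> N * norm v"
    and "0 \<le> N" "v \<in> P"
  shows "norm ((A ^^ k) v) \<le> N ^ k * norm v"
  using \<open>v \<in> P\<close>
proof (induction k arbitrary: v)
  case (Suc k)
  have "norm ((A ^^ Suc k) v) \<le> N ^ k * norm (A v)"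
    using Suc.IH[of "A v"] Suc.prems inv by (auto simp: funpow_swap1)
  also have "\<dots> \<le> N ^ k * (N * norm v)" using \<open>0 \<le> N\<close> Suc.prems le by (intro mult_left_mono) auto
  finally show ?case by (simp add: ac_simps)
qed simp

text \<open>
  The vector \<open>u\<close> is \<open>A\<^sup>m x\<close>, normalised.  Its forward orbit grows by \<open>paranormal_growth\<close>.  Its history
  \<open>u = A\<^sup>k v\<close>, for \<open>k \<le> m\<close>, controls the adjoint: \<open>1 = A\<^sup>k v \<bullet> u = v \<bullet> D\<^sup>k u \<le> \<parallel>v\<parallel> \<parallel>D\<^sup>k u\<parallel>\<close>, where \<open>\<parallel>v\<parallel>\<close> is at
  most \<open>1 / c\<^sup>k\<close>.  The preimages \<open>v\<close> are kept in the conclusion because their boundedness is what makes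
  compactness of a power of \<open>A\<close> applicable to a sequence of such \<open>u\<close>.
\<close>

lemma nearly_extremal_vector:
  fixes A D :: "'a::real_inner \<Rightarrow> 'a"
  assumes lin: "linear A" and adj: "\<And>x y. A x \<bullet> y = x \<bullet> D y"
    and cone: "cone P"
    and inv: "A ` P \<subseteq> P"
    and para: "\<forall>v\<in>P. (norm (A v))^2 \<le> norm (A (A v)) * norm v"
    and x: "x \<in> P" "norm x = 1" and c: "0 < c" "c \<le> norm (A x)"
  shows "\<exists>u\<in>P. norm u = 1 \<and> (\<forall>k. c ^ k \<le> norm ((A ^^ k) u)) \<and>
    (\<forall>k\<le>m. c ^ k \<le> norm ((D ^^ k) u) \<and> (\<exists>v. u = (A ^^ k) v \<and> c ^ k * norm v \<le> 1))"
proof -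
  define s where "s = norm ((A ^^ m) x)"
  define w where "w j = (1 / s) *\<^sub>R (A ^^ j) x" for j
  have cx: "c * norm x \<le> norm (A x)" using x c by simp
  note growth = paranormal_growth[OF lin inv para _ less_imp_le[OF c(1)]]
  have "0 < c ^ m * norm x" using c x by simp
  then have s: "0 < s" unfolding s_def using growth(3)[OF x(1) cx, of m] by linarith
  have w_P: "w j \<in> P" for j unfolding w_def using s by (intro mem_cone[OF cone] growth(1)[OF x(1) cx]) simp
  have lin_pow: "linear (A ^^ k)" for k
    using lin by (induction k) (auto simp: linear_compose id_def[symmetric] linear_id)
  have w_add: "(A ^^ k) (w j) = w (k + j)" for k j
    unfolding w_def by (simp add: linear_scale[OF lin_pow] funpow_add)
  have w_c: "c * norm (w j) \<le> norm (A (w j))" for j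
    using growth(2)[OF x(1) cx, of j] s
    by (simp add: w_def linear_scale[OF lin] field_simps)
  have w1: "norm (w m) = 1" using s by (simp add: w_def flip: s_def)
  have "c ^ k \<le> norm ((A ^^ k) (w m))" for k using growth(3)[OF w_P w_c, of k m] w1 by simp
  moreover have "c ^ k \<le> norm ((D ^^ k) (w m)) \<and> (\<exists>v. w m = (A ^^ k) v \<and> c ^ k * norm v \<le> 1)"
    if "k \<le> m" for k
  proof -
    define v where "v = w (m - k)"
    have v: "(A ^^ k) v = w m" using that by (simp add: v_def w_add)
    have v_le: "c ^ k * norm v \<le> 1" using growth(3)[OF w_P w_c, of k "m - k"] v w1 by (simp add: v_def)
    have "1 = v \<bullet> (D ^^ k) (w m)"
      using inner_funpow_adjoint[of A D, OF adj, of k v "w m"] v w1 by (simp add: norm_eq_1)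
    also have "\<dots> \<le> norm v * norm ((D ^^ k) (w m))" by (rule norm_cauchy_schwarz)
    finally have "c ^ k * 1 \<le> c ^ k * (norm v * norm ((D ^^ k) (w m)))"
      using c by (intro mult_left_mono) auto
    also have "\<dots> = (c ^ k * norm v) * norm ((D ^^ k) (w m))" by simp
    also have "\<dots> \<le> 1 * norm ((D ^^ k) (w m))" by (intro mult_right_mono v_le) simp
    finally show ?thesis using v[symmetric] v_le by auto
  qed
  ultimately show ?thesis using w_P w1 by blast
qed

text \<open>
  \<open>N\<close> is the norm of \<open>A\<close> on \<open>P\<close>; it bounds \<open>D\<close> on \<open>P\<close> too, since \<open>\<parallel>D v\<parallel>\<^sup>2 = A (D v) \<bullet> v\<close> and \<open>D v\<close> is in \<open>P\<close>.
  The vector \<open>z\<close> is a limit of vectors from \<open>nearly_extremal_vector\<close> with \<open>c\<close> tending to \<open>N\<close> and the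
  length \<open>m\<close> of the history tending to infinity.
\<close>

lemma extremal_vector:
  fixes A D :: "'a::real_inner \<Rightarrow> 'a"
  assumes A: "bounded_linear A" and D: "bounded_linear D" and adj: "\<And>x y. A x \<bullet> y = x \<bullet> D y"
    and closed: "closed P" and cone: "cone P"
    and invA: "A ` P \<subseteq> P" and invD: "D ` P \<subseteq> P"
    and para: "\<forall>v\<in>P. (norm (A v))^2 \<le> norm (A (A v)) * norm v"
    and comp: "compact_operator (A ^^ n)" and nz: "y \<in> P" "A y \<noteq> 0"
  obtains N z where "0 < N" "z \<in> P" "norm z = 1"
    "\<And>v. v \<in> P \<Longrightarrow> norm (A v) \<le> N * norm v" "\<And>v. v \<in> P \<Longrightarrow> norm (D v) \<le> N * norm v"
    "\<And>k. norm ((A ^^ k) z) = N ^ k" "\<And>k. norm ((D ^^ k) z) = N ^ k"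
proof -
  interpret A: bounded_linear A by fact
  have linA: "linear A" by (rule A.linear_axioms)
  define S where "S = (\<lambda>v. norm (A v)) ` {v \<in> P. norm v = 1}"
  define N where "N = Sup S"
  have bdd: "bdd_above S"
    unfolding S_def by (rule bdd_aboveI[of _ "onorm A"], clarsimp, metis onorm[OF A] mult.right_neutral)
  have unit: "norm (A v) / norm v \<in> S" if "v \<in> P" "v \<noteq> 0" for v
  proof -
    have "(1 / norm v) *\<^sub>R v \<in> {v \<in> P. norm v = 1}" using that by (auto intro: mem_cone[OF cone])
    moreover have "norm (A v) / norm v = norm (A ((1 / norm v) *\<^sub>R v))" by (simp add: A.scaleR)
    ultimately show ?thesis unfolding S_def by blast
  qed
  have boundA: "norm (A v) \<le> N * norm v" if "v \<in> P" for v
  proof (cases "v = 0")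
    case False
    then have "norm (A v) / norm v \<le> N"
      unfolding N_def using that by (intro cSup_upper unit bdd)
    then show ?thesis using False by (simp add: field_simps)
  qed (simp add: A.zero)
  have y0: "y \<noteq> 0" using nz A.zero by auto
  have "0 < norm (A y)" using nz by simp
  also have "\<dots> \<le> N * norm y" by (rule boundA[OF nz(1)])
  finally have N: "0 < N" by (simp add: zero_less_mult_iff)
  have boundD: "norm (D v) \<le> N * norm v" if "v \<in> P" for v
  proof (cases "D v = 0")
    case False
    have "norm (D v) * norm (D v) = A (D v) \<bullet> v"
      by (simp add: adj flip: power2_norm_eq_inner power2_eq_square)
    also have "\<dots> \<le> norm (A (D v)) * norm v" by (rule norm_cauchy_schwarz)
    also have "\<dots> \<le> (N * norm (D v)) * norm v"
      using invD that by (intro mult_right_mono boundA) auto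
    finally have "norm (D v) * norm (D v) \<le> norm (D v) * (N * norm v)" by (simp add: ac_simps)
    then show ?thesis using False by simp
  qed (use N in simp)
  \<comment> \<open>Below \<open>N\<close>, so that some unit vector of \<open>P\<close> exceeds \<open>c m\<close>, and at least \<open>N / 2\<close>,
    so that the preimages under \<open>A ^^ n\<close> stay bounded.\<close>
  define c where "c m = N * (real (Suc m) / real (Suc (Suc m)))" for m
  have c0: "0 < c m" for m unfolding c_def using N by simp
  have cN: "c m < N" for m unfolding c_def using N by (simp add: field_simps)
  have c_half: "N / 2 \<le> c m" for m unfolding c_def using N by (simp add: field_simps)
  have "c \<longlonglongrightarrow> N * 1"
    unfolding c_def by (intro tendsto_intros LIMSEQ_Suc[OF LIMSEQ_n_over_Suc_n])
  then have c_lim: "c \<longlonglongrightarrow> N" by simp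
  have "\<exists>u\<in>P. norm u = 1 \<and> (\<forall>k. c m ^ k \<le> norm ((A ^^ k) u)) \<and>
    (\<forall>k\<le>m. c m ^ k \<le> norm ((D ^^ k) u) \<and> (\<exists>v. u = (A ^^ k) v \<and> c m ^ k * norm v \<le> 1))" for m
  proof -
    have "S \<noteq> {}" using unit[OF nz(1) y0] by auto
    then obtain a where "a \<in> S" "c m < a" using less_cSupD[of S "c m"] cN[of m] unfolding N_def by auto
    then obtain x where "x \<in> P" "norm x = 1" "c m < norm (A x)" unfolding S_def by auto
    then show ?thesis
      by (intro nearly_extremal_vector[OF linA adj cone invA para _ _ c0]) auto
  qed
  then obtain u where u: "\<And>m. u m \<in> P" "\<And>m. norm (u m) = 1" "\<And>m k. c m ^ k \<le> norm ((A ^^ k) (u m))"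
    "\<And>m k. k \<le> m \<Longrightarrow> c m ^ k \<le> norm ((D ^^ k) (u m))"
    "\<And>m k. k \<le> m \<Longrightarrow> \<exists>v. u m = (A ^^ k) v \<and> c m ^ k * norm v \<le> 1"
    by metis
  \<comment> \<open>The shift gives every \<open>w m\<close> a preimage under \<open>A ^^ n\<close>, with norm at most \<open>B\<close>.\<close>
  define w where "w m = u (m + n)" for m
  define B where "B = 1 / (N / 2) ^ n"
  have w_mem: "w m \<in> closure ((A ^^ n) ` cball 0 B)" for m
  proof -
    obtain v where v: "u (m + n) = (A ^^ n) v" "c (m + n) ^ n * norm v \<le> 1"
      using u(5)[of n "m + n"] by auto
    have "(N / 2) ^ n * norm v \<le> c (m + n) ^ n * norm v"
      using N c_half by (intro mult_right_mono power_mono) auto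
    then have "(N / 2) ^ n * norm v \<le> 1" using v(2) by linarith
    moreover have "0 < (N / 2) ^ n" using N by simp
    ultimately have "norm v \<le> B" unfolding B_def by (simp add: pos_le_divide_eq mult.commute)
    then have "w m \<in> (A ^^ n) ` cball 0 B" unfolding w_def v(1) by auto
    then show ?thesis by (rule subsetD[OF closure_subset])
  qed
  have "compact (closure ((A ^^ n) ` cball 0 B))"
    using comp unfolding compact_operator_def by simp
  then obtain z r where r: "strict_mono r" and z: "(w \<circ> r) \<longlonglongrightarrow> z"
    using w_mem unfolding compact_def by meson
  have zP: "z \<in> P" using closed_sequentially[OF closed _ z] by (simp add: w_def u)
  have "(\<lambda>m. norm ((w \<circ> r) m)) \<longlonglongrightarrow> norm z" by (intro tendsto_norm z)
  then have z1: "norm z = 1" by (simp add: w_def u LIMSEQ_const_iff)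
  have "strict_mono (\<lambda>m. r m + n)" using r by (simp add: strict_mono_def)
  from LIMSEQ_subseq_LIMSEQ[OF c_lim this]
  have cr: "(\<lambda>m. c (r m + n) ^ k) \<longlonglongrightarrow> N ^ k" for k by (intro tendsto_power) (simp add: comp_def)
  have lim: "(\<lambda>m. norm ((T ^^ k) (w (r m)))) \<longlonglongrightarrow> norm ((T ^^ k) z)" if "bounded_linear T" for T :: "'a \<Rightarrow> 'a" and k
    using bounded_linear.tendsto[OF bounded_linear_funpow[OF that] z]
    by (intro tendsto_norm) (simp add: comp_def)
  have "N ^ k \<le> norm ((A ^^ k) z)" for k
    by (rule LIMSEQ_le[OF cr lim[OF A]]) (simp add: w_def u(3))
  moreover have "N ^ k \<le> norm ((D ^^ k) z)" for k
  proof (rule LIMSEQ_le[OF cr lim[OF D]], intro exI allI impI)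
    fix m assume "k \<le> m"
    then have "k \<le> r m + n" using seq_suble[OF r, of m] by linarith
    then show "c (r m + n) ^ k \<le> norm ((D ^^ k) (w (r m)))" unfolding w_def by (rule u(4))
  qed
  moreover have "norm ((A ^^ k) z) \<le> N ^ k" "norm ((D ^^ k) z) \<le> N ^ k" for k
    using norm_funpow_le[OF invA _ _ zP, of N k] norm_funpow_le[OF invD _ _ zP, of N k]
      boundA boundD N z1 by simp_all
  ultimately show thesis by (intro that[OF N zP z1 boundA boundD] order_antisym)
qed

text \<open>
  Equality case of Cauchy-Schwarz: \<open>D (A u) \<bullet> u = \<parallel>A u\<parallel>\<^sup>2 = N\<^sup>2 \<parallel>u\<parallel>\<^sup>2\<close> while \<open>\<parallel>D (A u)\<parallel> \<le> N\<^sup>2 \<parallel>u\<parallel>\<close>.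
\<close>

lemma adjoint_of_extremal:
  fixes A D :: "'a::real_inner \<Rightarrow> 'a"
  assumes adj: "\<And>x y. A x \<bullet> y = x \<bullet> D y"
    and u: "norm (A u) = N * norm u" "norm (D (A u)) \<le> N * norm (A u)"
  shows "D (A u) = N^2 *\<^sub>R u"
proof -
  have expand: "(norm (p - q))^2 = (norm p)^2 - 2 * (p \<bullet> q) + (norm q)^2" for p q :: 'a
    by (simp add: power2_norm_eq_inner inner_diff inner_commute)
  have "(norm (D (A u) - N^2 *\<^sub>R u))^2
      = (norm (D (A u)))^2 - 2 * N^2 * (D (A u) \<bullet> u) + (N^2 * norm u)^2"
    using expand[of "D (A u)" "N^2 *\<^sub>R u"] by (simp add: power_mult_distrib)
  also have "D (A u) \<bullet> u = (norm (A u))^2"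
    by (simp add: power2_norm_eq_inner adj inner_commute)
  also have "(norm (D (A u)))^2 \<le> (N * norm (A u))^2" using u(2) by (rule power_mono) simp
  finally have "(norm (D (A u) - N^2 *\<^sub>R u))^2 \<le> 0"
    by (simp add: u(1) power2_eq_square algebra_simps)
  then show ?thesis by simp
qed

text \<open>
  \<open>F\<close> consists of the vectors of \<open>P\<close> on which all powers of \<open>A\<close> and \<open>D\<close> attain the norm \<open>N\<^sup>k\<close>.  After
  scaling to \<open>N = 1\<close> this is the analogue, inside \<open>P\<close>, of the unitary part of a contraction, which is
  likewise invariant under the contraction and its adjoint.
\<close>

lemma normal_part_in_cone:
  fixes A D :: "'a::real_inner \<Rightarrow> 'a"
  assumes A: "bounded_linear A" and D: "bounded_linear D" and adj: "\<And>x y. A x \<bullet> y = x \<bullet> D y"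
    and closed: "closed P" and cone: "cone P"
    and invA: "A ` P \<subseteq> P" and invD: "D ` P \<subseteq> P"
    and para: "\<forall>v\<in>P. (norm (A v))^2 \<le> norm (A (A v)) * norm v"
    and comp: "compact_operator (A ^^ n)" and nz: "y \<in> P" "A y \<noteq> 0"
  obtains z F where "z \<in> F" "z \<noteq> 0" "F \<subseteq> P" "A ` F \<subseteq> F" "D ` F \<subseteq> F"
    "\<forall>u\<in>F. D (A u) = A (D u)"
proof -
  obtain N z where N: "0 < N" and z: "z \<in> P" "norm z = 1"
    and boundA: "\<And>v. v \<in> P \<Longrightarrow> norm (A v) \<le> N * norm v"
    and boundD: "\<And>v. v \<in> P \<Longrightarrow> norm (D v) \<le> N * norm v"
    and zk: "\<And>k. norm ((A ^^ k) z) = N ^ k" "\<And>k. norm ((D ^^ k) z) = N ^ k"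
    using extremal_vector[OF A D adj closed cone invA invD para comp nz] by blast
  have adj': "D x \<bullet> y = x \<bullet> A y" for x y using adj[of y x] by (simp add: inner_commute)
  define F where "F = {u \<in> P. \<forall>k. norm ((A ^^ k) u) = N ^ k * norm u \<and> norm ((D ^^ k) u) = N ^ k * norm u}"
  \<comment> \<open>Stated for \<open>S\<close> and \<open>T\<close> because it is used for \<open>A\<close> and \<open>D\<close> in both orders.\<close>
  have F_inv: "S u \<in> P \<and> T (S u) = N^2 *\<^sub>R u \<and>
      (\<forall>k. norm ((S ^^ k) (S u)) = N ^ k * norm (S u) \<and> norm ((T ^^ k) (S u)) = N ^ k * norm (S u))"
    if adj: "\<And>x y. S x \<bullet> y = x \<bullet> T y" and T: "bounded_linear T" and "S u \<in> P"
      and bound: "norm (T (S u)) \<le> N * norm (S u)"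
      and u: "\<And>k. norm ((S ^^ k) u) = N ^ k * norm u" "\<And>k. norm ((T ^^ k) u) = N ^ k * norm u"
    for S T u
  proof -
    have Su: "norm (S u) = N * norm u" using u(1)[of 1] by simp
    have TS: "T (S u) = N^2 *\<^sub>R u" by (rule adjoint_of_extremal[OF adj Su bound])
    have "norm ((S ^^ k) (S u)) = N ^ k * norm (S u)" for k
      using u(1)[of "Suc k"] Su by (simp add: funpow_swap1)
    moreover have "norm ((T ^^ k) (S u)) = N ^ k * norm (S u)" for k
    proof (cases k)
      case (Suc j)
      have "(T ^^ k) (S u) = (T ^^ j) (N^2 *\<^sub>R u)" using Suc TS by (simp add: funpow_swap1)
      also have "\<dots> = N^2 *\<^sub>R (T ^^ j) u"
        by (rule linear_scale[OF bounded_linear.linear[OF bounded_linear_funpow[OF T]]])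
      finally show ?thesis using Suc Su u(2)[of j] by (simp add: power2_eq_square)
    qed simp
    ultimately show ?thesis using TS that(3) by blast
  qed
  have FA: "A u \<in> F \<and> D (A u) = N^2 *\<^sub>R u" if "u \<in> F" for u
    using F_inv[of A D u, OF adj D] that invA boundD unfolding F_def by blast
  have FD: "D u \<in> F \<and> A (D u) = N^2 *\<^sub>R u" if "u \<in> F" for u
    using F_inv[of D A u, OF adj' A] that invD boundA unfolding F_def by blast
  show thesis
  proof (rule that[of z F])
    show "z \<in> F" using z zk by (simp add: F_def)
    show "F \<subseteq> P" by (auto simp: F_def)
  qed (use z FA FD in auto)
qed

section \<open>Positive self-commutators vanish\<close>

theorem proposition2p2:
  fixes A :: "'a::hilbert_lattice \<Rightarrow> 'a"
  assumes "positive_operator A"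
    and "power_compact A"
    and "positive_operator (self_commutator A)"
  shows "self_commutator A = (\<lambda>x. 0)"
proof -
  define D where "D = adjoint A"
  define C where "C = self_commutator A"
  obtain n where A: "bounded_linear A" and comp: "compact_operator (A ^^ n)"
    using assms(2) unfolding power_compact_def by blast
  have D: "bounded_linear D" unfolding D_def by (rule bounded_linear_adjoint[OF A])
  have adj: "A x \<bullet> y = x \<bullet> D y" for x y unfolding D_def by (rule adjoint_inner[OF A])
  have adj': "D x \<bullet> y = x \<bullet> A y" for x y using adj[of y x] by (simp add: inner_commute)
  have posA: "0 \<le> A x" if "0 \<le> x" for x using assms(1) that by (simp add: positive_operator_def)
  have posD: "0 \<le> D x" if "0 \<le> x" for x unfolding D_def by (rule positive_adjoint[OF A assms(1) that])
  have linC: "linear C" and posC: "\<And>x. 0 \<le> x \<Longrightarrow> 0 \<le> C x"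
    using assms(3) by (simp_all add: positive_operator_def C_def)
  have C: "C x = D (A x) - A (D x)" for x by (simp add: C_def D_def self_commutator_def)
  have C_sym: "C x \<bullet> y = x \<bullet> C y" for x y by (simp add: C inner_diff adj adj')
  \<comment> \<open>The union is itself one of these sets, hence the largest of them.\<close>
  define E where
    "E = \<Union>{F. F \<subseteq> {x. 0 \<le> x} \<and> A ` F \<subseteq> F \<and> D ` F \<subseteq> F \<and> (\<forall>u\<in>F. C u = 0)}"
  have E: "A x \<in> E" "D x \<in> E" "C x = 0" "0 \<le> x" if "x \<in> E" for x
    using that unfolding E_def by blast+
  define P where "P = {y. 0 \<le> y} \<inter> (\<Inter>x\<in>E. {y. y \<bullet> x = 0})"
  have P_iff: "y \<in> P \<longleftrightarrow> 0 \<le> y \<and> (\<forall>x\<in>E. y \<bullet> x = 0)" for y by (auto simp: P_def)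
  have closed: "closed P"
    unfolding P_def
    by (intro closed_Int closed_nonneg_cone closed_INT ballI closed_Collect_eq continuous_intros)
  have cone: "cone P" by (auto simp: cone_def P_iff scaleR_nonneg_nonneg)
  have invA: "A ` P \<subseteq> P" using E posA by (auto simp: P_iff adj)
  have invD: "D ` P \<subseteq> P" using E posD by (auto simp: P_iff adj')
  have para: "\<forall>v\<in>P. (norm (A v))^2 \<le> norm (A (A v)) * norm v"
    using positive_commutator_paranormal[OF A assms(1,3)] by (simp add: P_iff)
  have A0: "A y = 0" if yP: "y \<in> P" for y
  proof (rule ccontr)
    assume Ay: "A y \<noteq> 0"
    obtain z F where F: "z \<in> F" "z \<noteq> 0" "F \<subseteq> P" "A ` F \<subseteq> F" "D ` F \<subseteq> F"
      "\<forall>u\<in>F. D (A u) = A (D u)"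
      by (rule normal_part_in_cone[OF A D adj closed cone invA invD para comp yP Ay])
    have "F \<subseteq> {x. 0 \<le> x}" using F(3) by (auto simp: P_iff)
    then have "F \<subseteq> E" unfolding E_def using F by (intro Union_upper) (simp add: C)
    then have "z \<in> P" "z \<in> E" using F(1,3) by auto
    then have "z \<bullet> z = 0" unfolding P_iff by simp
    then show False using F by simp
  qed
  have C0: "C y = 0" if "y \<in> P" for y
  proof -
    have "D y \<bullet> D y = A (D y) \<bullet> y" by (simp add: adj)
    then have "D y = 0" using A0[of "D y"] invD that by auto
    then show ?thesis using A0[OF that] linear_0[OF bounded_linear.linear[OF A]]
      linear_0[OF bounded_linear.linear[OF D]] by (simp add: C)
  qed
  have C_cone: "C y = 0" if "0 \<le> y" for y
  proof -
    have "C y \<in> P" using posC[OF that] E by (simp add: P_iff C_sym)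
    then have "C y \<bullet> C y = 0" using C0 by (simp add: C_sym)
    then show ?thesis by simp
  qed
  have "C x = 0" for x
  proof -
    have "C x = C (pprt x) - C (- nprt x)"
      by (subst prts[of x]) (simp add: linear_add[OF linC] linear_neg[OF linC])
    then show ?thesis using C_cone by simp
  qed
  then show ?thesis by (auto simp: C_def)
qed

end
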